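(* The ERI space $(X_0,\tau_{\mathrm{ERI}})$ is not weakly Hausdorff.
   Context: Let $\overline{\mathbb{R}}=[-\infty,+\infty]$ be the extended real line with its order topology. Let $\sim$ be the equivalence relation on $\overline{\mathbb{R}}$ whose only non-singleton class is $\{-\infty,0,+\infty\}$, let $X_0=\overline{\mathbb{R}}/{\sim}$ be the quotient set, $q\colon\overline{\mathbb{R}}\to X_0$ the projection, and $\ast=q(-\infty)=q(0)=q(+\infty)$. The ERI topology $\tau_{\mathrm{ERI}}$ on $X_0$ consists of all $U\subseteq X_0$ such that (a) $q^{-1}(U)$ is open in $\overline{\mathbb{R}}$, and (b) if $\ast\in U$ then $q^{-1}(U)$ is dense in $\overline{\mathbb{R}}$. (This is a topology.) The ERI space is $X=(X_0,\tau_{\mathrm{ERI}})$. A space $X$ is weakly Hausdorff if for every compact Hausdorff space $K$ and continuous $f\colon K\to X$, the image $f(K)$ is closed in $X$. *)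

theory Defs
  imports "HOL-Analysis.Analysis"
begin

section \<open>Weakly Hausdorff spaces\<close>

text \<open>
  HOL cannot quantify over types inside a formula, so the test spaces \<open>K\<close> have to be topologies on
  a fixed type. For \<open>X\<close> on \<open>'a\<close> the type \<open>'a set set\<close> loses nothing: the lemma
  \<open>weakly_Hausdorff_space_closedin_image\<close> below gives the closed image property for test spaces
  over any type.
\<close>

definition weakly_Hausdorff_space :: "'a topology \<Rightarrow> bool" where
  "weakly_Hausdorff_space X \<longleftrightarrow>
     (\<forall>(K :: 'a set set topology) f.
        compact_space K \<and> Hausdorff_space K \<and> continuous_map K X f
          \<longrightarrow> closedin X (f ` topspace K))"

text \<open>
  Choose a section of \<open>f\<close> with image \<open>D\<close>. The closure of \<open>D\<close> has the same image as the whole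
  space, and its points are separated by the traces on \<open>D\<close> of their open neighbourhoods.
\<close>

lemma weakly_Hausdorff_space_closedin_image:
  fixes X :: "'a topology" and K :: "'k topology"
  assumes X: "weakly_Hausdorff_space X"
    and K: "compact_space K" "Hausdorff_space K"
    and f: "continuous_map K X f"
  shows "closedin X (f ` topspace K)"
proof -
  define S where "S = f ` topspace K"
  define g where "g = inv_into (topspace K) f"
  have g: "g s \<in> topspace K" "f (g s) = s" if "s \<in> S" for s
    using that unfolding S_def g_def by (auto simp: inv_into_into f_inv_into_f)
  define C where "C = K closure_of (g ` S)"
  have CK: "C \<subseteq> topspace K"
    unfolding C_def by (rule closure_of_subset_topspace)
  have DC: "g ` S \<subseteq> C"
    unfolding C_def by (rule closure_of_subset) (use g in auto)
  have topC: "topspace (subtopology K C) = C"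
    using CK by auto
  have fC: "f ` C = S"
  proof
    show "f ` C \<subseteq> S" using CK unfolding S_def by auto
    show "S \<subseteq> f ` C"
    proof
      fix s assume "s \<in> S"
      then show "s \<in> f ` C" using g(2)[of s] DC by (metis image_eqI image_subset_iff)
    qed
  qed
  define e :: "'k \<Rightarrow> 'a set set" where
    "e x = {g -` U \<inter> S | U. openin K U \<and> x \<in> U}" for x
  have inj: "inj_on e C"
  proof (rule inj_onI, rule ccontr)
    fix x y assume xy: "x \<in> C" "y \<in> C" "e x = e y" "x \<noteq> y"
    obtain U V where UV: "openin K U" "openin K V" "x \<in> U" "y \<in> V" "disjnt U V"
    proof -
      have "x \<in> topspace K" "y \<in> topspace K"
        using xy(1,2) CK by auto
      then show ?thesis
        using K(2) xy(4) that unfolding Hausdorff_space_def by metis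
    qed
    have "g -` U \<inter> S \<in> e x"
      unfolding e_def mem_Collect_eq by (intro exI[of _ U] conjI refl UV(1,3))
    then have "g -` U \<inter> S \<in> e y"
      by (simp only: xy(3))
    then obtain W where W: "openin K W" "y \<in> W" "g -` U \<inter> S = g -` W \<inter> S"
      unfolding e_def mem_Collect_eq by metis
    have "openin K (W \<inter> V)" "y \<in> W \<inter> V"
      using W(1,2) UV(2,4) by auto
    then obtain d where "d \<in> g ` S" "d \<in> W \<inter> V"
      using xy(2) unfolding C_def in_closure_of by metis
    then obtain s where "s \<in> S" "g s \<in> W \<inter> V"
      by auto
    then show False
      using W(3) UV(5) unfolding disjnt_def by auto
  qed
  define h where "h = inv_into C e"
  have he: "h (e x) = x" if "x \<in> C" for x
    using that inj unfolding h_def by simp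
  define L where "L = pullback_topology (e ` C) h (subtopology K C)"
  have topL: "topspace L = e ` C"
    unfolding L_def topspace_pullback_topology topC using he by auto
  have ch: "continuous_map L (subtopology K C) h"
    unfolding L_def using continuous_map_pullback[OF continuous_map_id] by auto
  have ce: "continuous_map (subtopology K C) L e"
    unfolding L_def
  proof (rule continuous_map_pullback')
    show "continuous_map (subtopology K C) (subtopology K C) (h \<circ> e)"
      by (rule continuous_map_eq[OF continuous_map_id]) (use topC he in auto)
    show "topspace (subtopology K C) \<subseteq> e -` e ` C"
      using topC by auto
  qed
  have "compact_space (subtopology K C)"
    unfolding C_def
    by (intro compact_space_subtopology closedin_compact_space K closedin_closure_of)
  then have "compact_space L"
    using image_compactin[OF _ ce] topC topL unfolding compact_space_def by metis
  moreover have "Hausdorff_space L"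
    by (rule Hausdorff_space_injective_preimage[OF Hausdorff_space_subtopology[OF K(2)] ch])
      (auto simp: topL inj_on_def he)
  moreover have "continuous_map L X (f \<circ> h)"
    by (rule continuous_map_compose[OF ch continuous_map_from_subtopology[OF f]])
  ultimately have "closedin X ((f \<circ> h) ` topspace L)"
    using X unfolding weakly_Hausdorff_space_def by blast
  moreover have "(f \<circ> h) ` topspace L = f ` C"
    unfolding topL using he by (auto simp: image_iff)
  ultimately show ?thesis
    using fC S_def by simp
qed

section \<open>The ERI space\<close>

definition eri_rel :: "(ereal \<times> ereal) set" where
  "eri_rel = {(x, y). x = y \<or> (x \<in> {-\<infinity>, 0, \<infinity>} \<and> y \<in> {-\<infinity>, 0, \<infinity>})}"

lemma equiv_eri_rel: "equiv UNIV eri_rel"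
  by (rule equivI) (auto simp: eri_rel_def refl_on_def sym_def trans_def)

definition eri_carrier :: "ereal set set" where
  "eri_carrier = UNIV // eri_rel"

definition eri_proj :: "ereal \<Rightarrow> ereal set" where
  "eri_proj x = eri_rel `` {x}"

definition eri_star :: "ereal set" where
  "eri_star = eri_proj 0"

lemma eri_star_eq: "eri_star = eri_proj (-\<infinity>)" "eri_star = eri_proj \<infinity>"
  by (auto simp: eri_star_def eri_proj_def eri_rel_def)

definition eri_open :: "ereal set set \<Rightarrow> bool" where
  "eri_open U \<longleftrightarrow>
     U \<subseteq> eri_carrier \<and> open (eri_proj -` U) \<and>
     (eri_star \<in> U \<longrightarrow> closure (eri_proj -` U) = UNIV)"

definition eri_space :: "ereal set topology" where
  "eri_space = topology eri_open"

lemma istopology_eri_open: "istopology eri_open"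
  unfolding istopology_def
proof (intro conjI allI impI)
  fix U V assume U: "eri_open U" and V: "eri_open V"
  have "closure (eri_proj -` U \<inter> eri_proj -` V) = UNIV" if "eri_star \<in> U \<inter> V"
  proof -
    have "eri_proj -` U \<subseteq> closure (eri_proj -` U \<inter> eri_proj -` V)"
      using open_Int_closure_subset[of "eri_proj -` U" "eri_proj -` V"] U V that
      unfolding eri_open_def by auto
    then have "closure (eri_proj -` U) \<subseteq> closure (eri_proj -` U \<inter> eri_proj -` V)"
      by (rule closure_minimal) simp
    then show ?thesis using U that unfolding eri_open_def by auto
  qed
  then show "eri_open (U \<inter> V)"
    using U V unfolding eri_open_def by auto
next
  fix \<U> assume \<U>: "\<forall>U\<in>\<U>. eri_open U"
  have "closure (eri_proj -` \<Union>\<U>) = UNIV" if star: "eri_star \<in> \<Union>\<U>"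
  proof -
    obtain U where "U \<in> \<U>" "eri_star \<in> U"
      using star by blast
    then have "closure (eri_proj -` U) = UNIV" "eri_proj -` U \<subseteq> eri_proj -` \<Union>\<U>"
      using \<U> unfolding eri_open_def by auto
    then show ?thesis using closure_mono by blast
  qed
  moreover have "open (eri_proj -` \<Union>\<U>)"
    using \<U> unfolding eri_open_def vimage_Union by auto
  ultimately show "eri_open (\<Union>\<U>)"
    using \<U> unfolding eri_open_def by blast
qed

lemma openin_eri_space: "openin eri_space U \<longleftrightarrow> eri_open U"
  by (simp add: eri_space_def istopology_eri_open)

lemma topspace_eri_space: "topspace eri_space = eri_carrier"
proof
  show "topspace eri_space \<subseteq> eri_carrier"
    unfolding topspace_def by (auto simp: openin_eri_space eri_open_def)
  have "eri_proj -` eri_carrier = UNIV"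
    by (auto simp: eri_proj_def eri_carrier_def quotientI)
  then have "openin eri_space eri_carrier"
    by (simp add: openin_eri_space eri_open_def)
  then show "eri_carrier \<subseteq> topspace eri_space"
    by (rule openin_subset)
qed

end

theory Submission
  imports Defs
begin

text \<open>
  The projection maps the compact interval from 1 to 2 continuously into the ERI space. The image is
  not closed: its complement contains the base point, but has a preimage that misses the open
  interval from 1 to 2 and hence is not dense.
\<close>

lemma Hausdorff_space_euclidean_t2: "Hausdorff_space (euclidean :: 'a::t2_space topology)"
  unfolding Hausdorff_space_def disjnt_def using hausdorff by auto

text \<open>The density condition only removes open sets from the quotient topology, and a coarser
  topology keeps the projection continuous.\<close>

lemma continuous_map_eri_proj: "continuous_map euclidean eri_space eri_proj"
  unfolding continuous_map_def
  by (auto simp: topspace_eri_space eri_proj_def eri_carrier_def quotientI openin_eri_space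
      eri_open_def vimage_def)

lemma eri_star_notin_image_eri_proj:
  assumes "S \<inter> {-\<infinity>, 0, \<infinity>} = {}"
  shows "eri_star \<notin> eri_proj ` S"
  using assms by (auto simp: eri_star_def eri_proj_def eri_rel_def set_eq_iff)

text \<open>The complement of the image is an open set around \<open>eri_star\<close>, so its
  preimage is dense. That preimage lies in \<open>- S\<close>, and a set with dense complement has
  empty interior.\<close>

lemma interior_eq_empty_if_closedin_image_eri_proj:
  assumes closed: "closedin eri_space (eri_proj ` S)" and S: "S \<inter> {-\<infinity>, 0, \<infinity>} = {}"
  shows "interior S = {}"
proof -
  let ?U = "eri_carrier - eri_proj ` S"
  have "eri_open ?U"
    using closed by (simp add: closedin_def topspace_eri_space openin_eri_space)
  moreover have "eri_star \<in> ?U"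
    using eri_star_notin_image_eri_proj[OF S]
    by (auto simp: eri_star_def eri_proj_def eri_carrier_def quotientI)
  ultimately have "closure (eri_proj -` ?U) = UNIV"
    unfolding eri_open_def by blast
  moreover have "closure (eri_proj -` ?U) \<subseteq> closure (- S)"
    by (rule closure_mono) auto
  ultimately show ?thesis
    by (auto simp: closure_complement)
qed

theorem proposition4p9:
  shows "\<not> weakly_Hausdorff_space eri_space"
proof
  assume "weakly_Hausdorff_space eri_space"
  moreover have "compact_space (top_of_set {1..2::ereal})"
    \<comment> \<open>\<open>ereal\<close> is itself compact, so closedness suffices.\<close>
    by (simp add: compact_space_subtopology compact_eq_closed)
  moreover have "Hausdorff_space (top_of_set {1..2::ereal})"
    by (intro Hausdorff_space_subtopology Hausdorff_space_euclidean_t2)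
  moreover have "continuous_map (top_of_set {1..2}) eri_space eri_proj"
    by (rule continuous_map_from_subtopology[OF continuous_map_eri_proj])
  \<comment> \<open>The test space lives on \<open>ereal\<close>, not on the type fixed in the
    definition, hence the transfer lemma.\<close>
  ultimately have "closedin eri_space (eri_proj ` topspace (top_of_set {1..2}))"
    by (rule weakly_Hausdorff_space_closedin_image)
  then have "interior {1..2::ereal} = {}"
    by (intro interior_eq_empty_if_closedin_image_eri_proj) auto
  moreover have "{1<..<2::ereal} \<subseteq> interior {1..2}"
    by (rule interior_maximal) auto
  moreover obtain x :: ereal where "1 < x" "x < 2"
    using dense[of "1::ereal" 2] by auto
  ultimately show False
    by auto
qed

end
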